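(* Let $X$ be a coded system (a two-sided subshift over a finite alphabet that admits a generator), with shift map $\sigma$. Then $(X,\sigma)$ is mixing if and only if $(X,\sigma)$ is totally transitive.
   Context: Let $A$ be a finite alphabet and give $A^{\mathbb{Z}}$ the product topology of the discrete topology on $A$. The shift map is $\sigma((a_i)_{i\in\mathbb{Z}})=(a_{i+1})_{i\in\mathbb{Z}}$. A subshift is a nonempty closed $\sigma$-invariant subset $X\subseteq A^{\mathbb{Z}}$, with $\sigma$ restricted to it. Its language $\mathcal{L}(X)$ is the set of finite words occurring as consecutive entries in some point of $X$. Coded system: a subshift $X$ is coded if there is a countable set $\mathcal{W}$ of (nonempty) finite words over $A$, called a generator of $X$, such that $X$ is the closure of the set of all bi-infinite sequences obtained by concatenating elements of $\mathcal{W}$ in arbitrary order (with arbitrary position of the origin). Equivalently, $\mathcal{L}(X)$ is the set of all subwords of finite concatenations of elements of $\mathcal{W}$. One writes $X=X(\mathcal{W})$. For a compact metric space $X$, a homeomorphism $T:X\to X$ and nonempty open sets $U,V\subseteq X$, put $N(U,V)=\{n\in\mathbb{Z}: U\cap T^{-n}V\neq\emptyset\}$. The system $(X,T)$ is transitive if $N(U,V)\neq\emptyset$ for all nonempty open $U,V$. It is totally transitive if $(X,T^n)$ is transitive for every nonzero integer $n$. It is mixing (strong mixing) if $N(U,V)$ is cofinite for all nonempty open $U,V$. *)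

theory Defs
  imports "HOL-Analysis.Analysis"
begin

definition full_shift :: "'a set \<Rightarrow> (int \<Rightarrow> 'a) topology" where
  "full_shift A = product_topology (\<lambda>_. discrete_topology A) UNIV"

definition shift_map :: "(int \<Rightarrow> 'a) \<Rightarrow> (int \<Rightarrow> 'a)" where
  "shift_map x = (\<lambda>i. x (i + 1))"

definition subshift :: "'a set \<Rightarrow> (int \<Rightarrow> 'a) set \<Rightarrow> bool" where
  "subshift A X \<longleftrightarrow> X \<noteq> {} \<and> closedin (full_shift A) X \<and> shift_map ` X = X"

text \<open>Bi-infinite concatenations of words from \<open>W\<close>: word number \<open>j\<close> occupies the coordinates
  \<open>k j, \<dots>, k (j + 1) - 1\<close>.  The cut points \<open>k j\<close> are strictly increasing integers, hence
  unbounded in both directions; nothing forces a cut at the origin.\<close>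

definition bi_concatenations :: "'a list set \<Rightarrow> (int \<Rightarrow> 'a) set" where
  "bi_concatenations W =
     {x. \<exists>k :: int \<Rightarrow> int. strict_mono k \<and> (\<forall>j. map x [k j..k (j + 1) - 1] \<in> W)}"

definition generator :: "'a set \<Rightarrow> (int \<Rightarrow> 'a) set \<Rightarrow> 'a list set \<Rightarrow> bool" where
  "generator A X W \<longleftrightarrow> countable W \<and> W \<subseteq> lists A \<and> [] \<notin> W \<and>
     X = full_shift A closure_of bi_concatenations W"

definition coded_system :: "'a set \<Rightarrow> (int \<Rightarrow> 'a) set \<Rightarrow> bool" where
  "coded_system A X \<longleftrightarrow> subshift A X \<and> (\<exists>W. generator A X W)"

text \<open>A dynamical system is given by a topology \<open>S\<close> and a self-homeomorphism \<open>T\<close> of \<open>topspace S\<close>;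
  values of \<open>T\<close> outside \<open>topspace S\<close> are irrelevant, so negative powers use the inverse
  of \<open>T\<close> on \<open>topspace S\<close>.\<close>

definition int_power :: "'b topology \<Rightarrow> ('b \<Rightarrow> 'b) \<Rightarrow> int \<Rightarrow> 'b \<Rightarrow> 'b" where
  "int_power S T n =
     (if 0 \<le> n then T ^^ nat n else inv_into (topspace S) T ^^ nat (- n))"

definition return_times ::
    "'b topology \<Rightarrow> ('b \<Rightarrow> 'b) \<Rightarrow> 'b set \<Rightarrow> 'b set \<Rightarrow> int set" where
  "return_times S T U V = {n. U \<inter> int_power S T n -` V \<noteq> {}}"

definition transitive :: "'b topology \<Rightarrow> ('b \<Rightarrow> 'b) \<Rightarrow> bool" where
  "transitive S T \<longleftrightarrow>
     (\<forall>U V. openin S U \<and> openin S V \<and> U \<noteq> {} \<and> V \<noteq> {} \<longrightarrow> return_times S T U V \<noteq> {})"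

definition totally_transitive :: "'b topology \<Rightarrow> ('b \<Rightarrow> 'b) \<Rightarrow> bool" where
  "totally_transitive S T \<longleftrightarrow> (\<forall>n. n \<noteq> 0 \<longrightarrow> transitive S (int_power S T n))"

definition mixing :: "'b topology \<Rightarrow> ('b \<Rightarrow> 'b) \<Rightarrow> bool" where
  "mixing S T \<longleftrightarrow>
     (\<forall>U V. openin S U \<and> openin S V \<and> U \<noteq> {} \<and> V \<noteq> {} \<longrightarrow> finite (- return_times S T U V))"

end

theory Submission
  imports Defs
begin

text \<open>Let \<open>W\<close> generate \<open>X\<close> and let \<open>d\<close> be the greatest common divisor of the lengths of the words
  in \<open>W\<close>.  The cuts of a bi-infinite concatenation all lie in one residue class mod \<open>d\<close>, so the
  concatenations split into \<open>d\<close> classes, each invariant under the \<open>d\<close>-th power of the shift, which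
  the shift permutes cyclically.  If that power is transitive, one class is dense, hence all are.
  So for every residue class mod \<open>d\<close> each nonempty open set is witnessed by a finite concatenation
  placed at a position in that class; as all large multiples of \<open>d\<close> are lengths of concatenations,
  two such blocks can be joined at every sufficiently large distance.\<close>

section \<open>Additive sets of natural numbers\<close>

text \<open>Bezout coefficients are avoided by taking \<open>d\<close> to be the least positive
  difference of two elements of \<open>S\<close>. Nonnegative combinations of \<open>a\<close> and
  \<open>a + d\<close> then produce all large multiples of \<open>d\<close>.\<close>

lemma additive_set_eventually_multiples:
  fixes S :: "nat set"
  assumes zero: "0 \<in> S" and add: "\<And>a b. a \<in> S \<Longrightarrow> b \<in> S \<Longrightarrow> a + b \<in> S"
    and pos: "s \<in> S" "0 < s"
  obtains d N where "0 < d" "\<And>a. a \<in> S \<Longrightarrow> d dvd a" "\<And>n. N \<le> n \<Longrightarrow> d dvd n \<Longrightarrow> n \<in> S"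
proof -
  have mult: "q * a \<in> S" if "a \<in> S" for q a
    by (induction q) (use that zero add in auto)
  define P where "P d \<longleftrightarrow> 0 < d \<and> (\<exists>a\<in>S. a + d \<in> S)" for d
  define d where "d = (LEAST d. P d)"
  have "P s" using pos zero by (auto simp: P_def intro!: bexI[of _ 0])
  then have "P d" unfolding d_def by (rule LeastI)
  then obtain a where d: "0 < d" and a: "a \<in> S" "a + d \<in> S" by (auto simp: P_def)
  have dvd: "d dvd t" if t: "t \<in> S" for t
  proof (rule ccontr)
    assume "\<not> d dvd t"
    then have r: "0 < t mod d" by (simp add: dvd_eq_mod_eq_0)
    \<comment> \<open>This exhibits \<open>t mod d\<close> as the difference of two elements of
      \<open>S\<close>, against the minimality of \<open>d\<close>.\<close>
    have "(t div d) * (a + d) + t mod d = t + (t div d) * a"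
      by (simp add: algebra_simps)
    then have "P (t mod d)"
      using r mult[OF a(2), of "t div d"] add[OF t mult[OF a(1), of "t div d"]]
      unfolding P_def by metis
    then have "d \<le> t mod d" unfolding d_def by (rule Least_le)
    then show False using mod_less_divisor[OF d, of t] by linarith
  qed
  obtain k where k: "a = d * k" using dvd[OF a(1)] by blast
  \<comment> \<open>The bound makes the quotient \<open>j div k\<close> at least \<open>k\<close>,
    hence larger than the remainder \<open>j mod k\<close>, so the coefficient \<open>e\<close> of
    \<open>a\<close> is a natural number. For \<open>k = 0\<close> also \<open>a = 0\<close>, and
    \<open>d\<close> itself lies in \<open>S\<close>.\<close>
  have "n \<in> S" if n: "d * k * k \<le> n" "d dvd n" for n
  proof (cases "k = 0")
    case True
    then show ?thesis using a n mult[of d] k by (auto simp: dvd_def mult.commute)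
  next
    case False
    obtain j where j: "n = d * j" using n(2) by blast
    have "k * k \<le> j" using n(1) d j by (simp add: mult.assoc)
    then have "k \<le> j div k" using False by (simp add: less_eq_div_iff_mult_less_eq)
    moreover have "j mod k < k" using False by simp
    ultimately obtain e where e: "j div k = j mod k + e"
      by (metis less_imp_le le_trans le_Suc_ex)
    define p where "p = j mod k"
    have "j = (p + e) * k + p" using e div_mult_mod_eq[of j k] by (simp add: p_def)
    then have "n = e * a + p * (a + d)" unfolding j k by (simp add: algebra_simps)
    then show ?thesis using add[OF mult[OF a(1)] mult[OF a(2)]] by simp
  qed
  with d dvd that show ?thesis by blast
qed

section \<open>Strictly increasing integer sequences and words read off a point\<close>

lemma strict_mono_int_stepI:
  fixes k :: "int \<Rightarrow> int"
  assumes "\<And>j. k j < k (j + 1)"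
  shows "strict_mono k"
proof (rule strict_monoI)
  fix i j :: int assume "i < j"
  then show "k i < k j"
  proof (induction j rule: int_gr_induct)
    case base then show ?case by (rule assms)
  next
    case (step j) then show ?case using assms[of j] by linarith
  qed
qed

lemma strict_mono_int_ge:
  fixes k :: "int \<Rightarrow> int"
  assumes "strict_mono k" "i \<le> j"
  shows "j - i \<le> k j - k i"
  using assms(2)
proof (induction j rule: int_ge_induct)
  case (step j)
  have "k j < k (j + 1)" using assms(1) by (simp add: strict_mono_less)
  with step show ?case by linarith
qed simp

lemma map_upto_eq_iff:
  "map x [a..a + int (length w) - 1] = w \<longleftrightarrow> (\<forall>t<length w. x (a + int t) = w ! t)"
proof -
  have "map x [a..a + int (length w) - 1] = map (\<lambda>t. x (a + int t)) [0..<length w]"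
    by (rule nth_equalityI) auto
  then show ?thesis by (simp only: list_eq_iff_nth_eq length_map length_upt) simp
qed

section \<open>Integer powers of the shift\<close>

text \<open>Negative \<open>n\<close> is allowed, so these maps form a group and
  \<open>inv_into\<close> can be eliminated from the powers of the shift.\<close>

definition shift_by :: "int \<Rightarrow> (int \<Rightarrow> 'a) \<Rightarrow> int \<Rightarrow> 'a" where
  "shift_by n x = (\<lambda>i. x (i + n))"

lemma shift_by_add [simp]: "shift_by m (shift_by n x) = shift_by (m + n) x"
  by (simp add: shift_by_def add.assoc)

lemma shift_by_0 [simp]: "shift_by 0 x = x"
  by (simp add: shift_by_def)

lemma shift_map_eq: "shift_map = shift_by 1"
  by (simp add: fun_eq_iff shift_map_def shift_by_def)

lemma shift_by_in:
  assumes "shift_map ` X = X" "x \<in> X"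
  shows "shift_by n x \<in> X"
proof -
  have up: "shift_by (int m) x \<in> X" if "x \<in> X" for m x
  proof (induction m)
    case (Suc m)
    have "shift_by (int (Suc m)) x = shift_map (shift_by (int m) x)"
      by (simp add: shift_map_eq)
    then show ?case using Suc assms(1) by blast
  qed (use that in simp)
  have down: "shift_by (- int m) x \<in> X" if "x \<in> X" for m x
  proof (induction m)
    case (Suc m)
    then obtain y where y: "y \<in> X" "shift_by (- int m) x = shift_map y"
      using assms(1) by (metis imageE)
    have "shift_by (- int (Suc m)) x = shift_by (- 1) (shift_by (- int m) x)" by simp
    also have "\<dots> = y" unfolding y(2) by (simp add: shift_map_eq)
    finally show ?case using y by simp
  qed (use that in simp)
  show ?thesis using up[OF assms(2)] down[OF assms(2)] by (metis int_cases2)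
qed

text \<open>\<open>T\<close> has to agree with a shift only on \<open>X\<close>. Hence this serves
  both for \<open>shift_map\<close> and for the maps \<open>int_power S shift_map c\<close>, whose
  behaviour outside \<open>X\<close> is not controlled.\<close>

lemma int_power_shift_by:
  assumes X: "topspace S = X" "\<And>n x. x \<in> X \<Longrightarrow> shift_by n x \<in> X"
    and T: "\<And>x. x \<in> X \<Longrightarrow> T x = shift_by c x" and x: "x \<in> X"
  shows "int_power S T n x = shift_by (c * n) x"
proof -
  have inj: "inj_on T X"
  proof (rule inj_onI)
    fix x y assume "x \<in> X" "y \<in> X" "T x = T y"
    then have "shift_by (- c) (shift_by c x) = shift_by (- c) (shift_by c y)" using T by metis
    then show "x = y" by simp
  qed
  have inv: "inv_into X T x = shift_by (- c) x" if "x \<in> X" for x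
    by (rule inv_into_f_eq[OF inj]) (use that X T in auto)
  have "(T ^^ m) x = shift_by (c * int m) x" for m
    by (induction m) (simp_all add: T X x algebra_simps)
  moreover have "(inv_into X T ^^ m) x = shift_by (- c * int m) x" for m
    by (induction m) (simp_all add: inv X x algebra_simps)
  ultimately show ?thesis by (simp add: int_power_def X)
qed

section \<open>Topology of the full shift\<close>

lemma topspace_full_shift: "topspace (full_shift A) = {x. range x \<subseteq> A}"
  by (auto simp: full_shift_def PiE_UNIV_domain)

text \<open>A basic open set of the product restricts finitely many coordinates, and these fit into
  a window symmetric about the origin.\<close>

lemma openin_full_shift_window:
  assumes "openin (subtopology (full_shift A) X) U" "x \<in> U" "X \<subseteq> topspace (full_shift A)"
  obtains r where "0 \<le> r" "\<And>y. y \<in> X \<Longrightarrow> (\<And>i. - r \<le> i \<Longrightarrow> i \<le> r \<Longrightarrow> y i = x i) \<Longrightarrow> y \<in> U"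
proof -
  obtain V where V: "openin (full_shift A) V" "U = V \<inter> X"
    using assms(1) by (auto simp: openin_subtopology)
  then have "x \<in> V" using assms(2) by simp
  then obtain F where F: "finite {i. F i \<noteq> A}" "x \<in> Pi\<^sub>E UNIV F" "Pi\<^sub>E UNIV F \<subseteq> V"
    using V(1) unfolding full_shift_def openin_product_topology_alt by auto
  \<comment> \<open>Inserting 0 keeps \<open>Max\<close> meaningful when no coordinate is
    restricted.\<close>
  define r where "r = Max (insert 0 (abs ` {i. F i \<noteq> A}))"
  have r: "\<bar>i\<bar> \<le> r" if "F i \<noteq> A" for i
    unfolding r_def using F(1) that by (intro Max_ge) auto
  show ?thesis
  proof (rule that[of r])
    show "0 \<le> r" unfolding r_def using F(1) by (intro Max_ge) auto
  next
    fix y assume "y \<in> X"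
      and eq: "\<And>i. - r \<le> i \<Longrightarrow> i \<le> r \<Longrightarrow> y i = x i"
    then have y: "y \<in> X" "y \<in> topspace (full_shift A)" using assms(3) by auto
    have "y i \<in> F i" for i
    proof (cases "F i = A")
      case True then show ?thesis using y by (auto simp: topspace_full_shift)
    next
      case False
      then have "y i = x i" using eq r[of i] by (simp add: abs_le_iff)
      then show ?thesis using F(2) by (auto simp: PiE_UNIV_domain)
    qed
    then have "y \<in> V" using F(3) by (auto simp: PiE_UNIV_domain)
    then show "y \<in> U" using y V by simp
  qed
qed

lemma continuous_map_shift_by:
  "continuous_map (full_shift A) (full_shift A) (shift_by n)"
proof -
  have "continuous_map (full_shift A) (discrete_topology A) (\<lambda>x. x (i + n))" for i
    unfolding full_shift_def by (rule continuous_map_product_projection) simp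
  then show ?thesis
    by (subst (2) full_shift_def) (auto simp: continuous_map_componentwise_UNIV shift_by_def)
qed

section \<open>Transitivity and finite families of invariant sets\<close>

text \<open>Take \<open>U\<close> meeting as few of the sets \<open>B i\<close> as possible.
  Transitivity carries an open part of \<open>U\<close> into any given \<open>V\<close>; by
  minimality that part meets the same \<open>B i\<close> as \<open>U\<close>, and by invariance
  \<open>V\<close> meets them too. So every \<open>B i\<close> that meets \<open>U\<close> is
  dense.\<close>

lemma transitive_finite_cover_dense:
  assumes trans: "transitive S T" and "finite I"
    and dense: "\<And>U. openin S U \<Longrightarrow> U \<noteq> {} \<Longrightarrow> \<exists>i\<in>I. U \<inter> B i \<noteq> {}"
    and cont: "\<And>n V. openin S V \<Longrightarrow> openin S {x \<in> topspace S. int_power S T n x \<in> V}"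
    and inv: "\<And>n i x. i \<in> I \<Longrightarrow> x \<in> B i \<Longrightarrow> x \<in> topspace S \<Longrightarrow> int_power S T n x \<in> B i"
    and "topspace S \<noteq> {}"
  shows "\<exists>i\<in>I. \<forall>U. openin S U \<longrightarrow> U \<noteq> {} \<longrightarrow> U \<inter> B i \<noteq> {}"
proof -
  define J where "J U = {i\<in>I. U \<inter> B i \<noteq> {}}" for U
  have fin: "finite (J U)" for U using \<open>finite I\<close> by (simp add: J_def)
  have "openin S (topspace S) \<and> topspace S \<noteq> {}" using assms by simp
  then obtain U where U: "openin S U" "U \<noteq> {}"
    and least: "\<And>V. openin S V \<Longrightarrow> V \<noteq> {} \<Longrightarrow> card (J U) \<le> card (J V)"
    using ex_has_least_nat[of "\<lambda>U. openin S U \<and> U \<noteq> {}" "topspace S" "\<lambda>U. card (J U)"] by auto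
  have "J U \<subseteq> J V" if V: "openin S V" "V \<noteq> {}" for V
  proof -
    obtain n x where n: "x \<in> U" "int_power S T n x \<in> V"
      using trans U V unfolding transitive_def return_times_def by fast
    define U' where "U' = U \<inter> {x \<in> topspace S. int_power S T n x \<in> V}"
    have "openin S U'" "U' \<noteq> {}"
      using U cont[OF V(1)] n openin_subset[OF U(1)] by (auto simp: U'_def)
    then have "card (J U) \<le> card (J U')" by (rule least)
    moreover have "J U' \<subseteq> J U" by (auto simp: J_def U'_def)
    ultimately have "J U' = J U" using fin by (simp add: card_seteq)
    moreover have "J U' \<subseteq> J V" using inv by (fastforce simp: J_def U'_def)
    ultimately show ?thesis by simp
  qed
  moreover obtain i where "i \<in> J U" using dense[OF U] by (auto simp: J_def)
  ultimately show ?thesis unfolding J_def by blast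
qed

section \<open>Cut points and their residue classes\<close>

definition cutting :: "'a list set \<Rightarrow> (int \<Rightarrow> 'a) \<Rightarrow> (int \<Rightarrow> int) \<Rightarrow> bool" where
  "cutting W x k \<longleftrightarrow> strict_mono k \<and> (\<forall>j. map x [k j..k (j + 1) - 1] \<in> W)"

text \<open>Only the cut \<open>k 0\<close> is tested: once \<open>d\<close> divides all word
  lengths, the other cuts are congruent to it.\<close>

definition aligned :: "'a list set \<Rightarrow> nat \<Rightarrow> int \<Rightarrow> (int \<Rightarrow> 'a) set" where
  "aligned W d c = {x. \<exists>k. cutting W x k \<and> int d dvd k 0 - c}"

lemma bi_concatenations_eq: "bi_concatenations W = {x. \<exists>k. cutting W x k}"
  by (simp add: bi_concatenations_def cutting_def)

lemma cutting_shift_by: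
  assumes "cutting W x k"
  shows "cutting W (shift_by n x) (\<lambda>j. k j - n)"
proof -
  have "map (shift_by n x) [a - n..b - n - 1] = map x [a..b - 1]" for a b
    by (auto simp: list_eq_iff_nth_eq shift_by_def)
  then show ?thesis using assms by (auto simp: cutting_def strict_mono_def)
qed

lemma aligned_shift_by:
  assumes "x \<in> aligned W d c"
  shows "shift_by n x \<in> aligned W d (c - n)"
proof -
  obtain k where "cutting W x k" "int d dvd k 0 - c" using assms by (auto simp: aligned_def)
  then show ?thesis
    using cutting_shift_by[of W x k n] by (auto simp: aligned_def intro!: exI[of _ "\<lambda>j. k j - n"])
qed

lemma aligned_cong:
  assumes "int d dvd c - c'"
  shows "aligned W d c \<subseteq> aligned W d c'"
proof
  fix x assume "x \<in> aligned W d c"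
  then obtain k where k: "cutting W x k" "int d dvd k 0 - c" by (auto simp: aligned_def)
  have "int d dvd k 0 - c'" using dvd_add[OF k(2) assms] by simp
  with k show "x \<in> aligned W d c'" by (auto simp: aligned_def)
qed

lemma cutting_blocks:
  assumes "cutting W x k"
  shows "\<exists>ws\<in>lists W. map x [k i..k (i + int n) - 1] = concat ws"
proof (induction n)
  case 0 then show ?case by (auto intro!: bexI[of _ "[]"])
next
  case (Suc n)
  then obtain ws where ws: "ws \<in> lists W" "map x [k i..k (i + int n) - 1] = concat ws" by blast
  let ?v = "map x [k (i + int n)..k (i + int n + 1) - 1]"
  have mono: "strict_mono k" and v: "?v \<in> W" using assms by (auto simp: cutting_def)
  have "k i \<le> k (i + int n)" "k (i + int n) < k (i + int n + 1)"
    using mono by (auto simp: strict_mono_less strict_mono_less_eq)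
  then have "[k i..k (i + int n + 1) - 1]
      = [k i..k (i + int n) - 1] @ [k (i + int n)..k (i + int n + 1) - 1]"
    by (intro upto_split1) auto
  then have "map x [k i..k (i + int (Suc n)) - 1] = concat (ws @ [?v])"
    using ws by (simp add: algebra_simps)
  then show ?case using ws v by (intro bexI[of _ "ws @ [?v]"]) auto
qed

text \<open>The word is read between two distant cuts. Its left end differs from \<open>k 0\<close>
  by the length of a concatenation, so it inherits the residue of \<open>k 0\<close>.\<close>

lemma aligned_window:
  assumes x: "x \<in> aligned W d c" and d: "\<And>ws. ws \<in> lists W \<Longrightarrow> d dvd length (concat ws)"
  obtains a ws where "ws \<in> lists W" "a \<le> - r" "r < a + int (length (concat ws))" "int d dvd a - c"
    "\<And>t. t < length (concat ws) \<Longrightarrow> x (a + int t) = concat ws ! t"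
proof -
  obtain k where k: "cutting W x k" "int d dvd k 0 - c" using x by (auto simp: aligned_def)
  have mono: "strict_mono k" using k by (simp add: cutting_def)
  \<comment> \<open>Cuts advance by at least 1 per index, so \<open>R\<close> steps from
    \<open>k 0\<close> lead past the window on either side, wherever \<open>k 0\<close>
    lies.\<close>
  define R where "R = nat (\<bar>r\<bar> + \<bar>k 0\<bar> + 1)"
  define a where "a = k (- int R)"
  define b where "b = k (int R)"
  have "int R = \<bar>r\<bar> + \<bar>k 0\<bar> + 1" by (simp add: R_def)
  then have a: "a \<le> - r" and b: "r < b"
    using strict_mono_int_ge[OF mono, of "- int R" 0] strict_mono_int_ge[OF mono, of 0 "int R"]
    unfolding a_def b_def by linarith+
  have "a \<le> k 0" unfolding a_def using mono by (simp add: strict_mono_less_eq)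
  obtain us where us: "us \<in> lists W" "map x [a..k 0 - 1] = concat us"
    using cutting_blocks[OF k(1), of "- int R" R] unfolding a_def by auto
  have "int (length (concat us)) = k 0 - a"
    using arg_cong[OF us(2), of length] \<open>a \<le> k 0\<close> by simp
  then have "int d dvd k 0 - a" using d[OF us(1)] by (metis int_dvd_int_iff)
  then have dvd: "int d dvd a - c" using dvd_diff[OF k(2), of "k 0 - a"] by simp
  have "- int R + int (2 * R) = int R" by simp
  then obtain ws where ws: "ws \<in> lists W" "map x [a..b - 1] = concat ws"
    using cutting_blocks[OF k(1), of "- int R" "2 * R"] unfolding a_def b_def by metis
  have "a \<le> b" unfolding a_def b_def using mono by (simp add: strict_mono_less_eq)
  then have len: "b = a + int (length (concat ws))"
    using arg_cong[OF ws(2), of length] by simp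
  show ?thesis
    using that[OF ws(1) a _ dvd] b ws(2) map_upto_eq_iff[of x a "concat ws"] unfolding len by blast
qed

text \<open>Repeating \<open>concat ws\<close> periodically extends a finite concatenation to a
  bi-infinite one; a final shift places one period at \<open>a\<close>.\<close>

lemma periodic_concatenation:
  assumes ws: "ws \<in> lists W" "ws \<noteq> []" and ne: "[] \<notin> W"
  obtains z where "z \<in> bi_concatenations W"
    "\<And>t. t < length (concat ws) \<Longrightarrow> z (a + int t) = concat ws ! t"
proof -
  define u where "u = concat ws"
  define L where "L = int (length u)"
  define m where "m = int (length ws)"
  \<comment> \<open>\<open>c r\<close> is the offset of word \<open>r\<close> within one period. Cut
    \<open>j\<close> adds it to \<open>j div m\<close> full periods of length \<open>L\<close>;
    since \<open>div\<close> rounds down, this also covers negative \<open>j\<close>.\<close>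
  define c where "c r = int (length (concat (take r ws)))" for r
  define k where "k j = (j div m) * L + c (nat (j mod m))" for j
  define x where "x i = u ! nat (i mod L)" for i
  have m: "0 < m" using ws by (simp add: m_def)
  have c_Suc: "c (Suc r) = c r + int (length (ws ! r))" if "r < length ws" for r
    using that by (simp add: c_def take_Suc_conv_app_nth)
  have c_0: "c 0 = 0" and c_m: "c (nat m) = L" by (simp_all add: c_def m_def L_def u_def)
  define w where "w j = ws ! nat (j mod m)" for j
  have r: "nat (j mod m) < length ws" for j
    using m by (simp add: m_def nat_less_iff)
  have w: "w j \<in> W" for j
    using ws nth_mem[OF r[of j]] by (auto simp: w_def)
  then have w_ne: "w j \<noteq> []" for j using ne by metis
  have step: "k (j + 1) = k j + int (length (w j))" for j
  proof (cases "j mod m = m - 1")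
    case True
    \<comment> \<open>After the last word of a period the index wraps to 0, and the full offset
      \<open>c (nat m) = L\<close> becomes one more period.\<close>
    have j1: "j + 1 = (j div m + 1) * m"
      unfolding distrib_right using True div_mult_mod_eq[of j m] by linarith
    have "(j + 1) div m = j div m + 1" "(j + 1) mod m = 0"
      unfolding j1 using m by simp_all
    moreover have "Suc (nat (j mod m)) = nat m" using True m by simp
    ultimately show ?thesis
      using c_Suc[OF r[of j]] c_0 c_m by (simp add: k_def w_def algebra_simps)
  next
    case False
    moreover have "0 \<le> j mod m" "j mod m < m" using m by simp_all
    ultimately have b: "0 \<le> j mod m + 1" "j mod m + 1 < m" by auto
    have j1: "j + 1 = m * (j div m) + (j mod m + 1)"
      using mult_div_mod_eq[of m j] by simp
    have "(j + 1) div m = j div m" "(j + 1) mod m = j mod m + 1"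
      by (rule int_div_pos_eq[OF j1 b], rule int_mod_pos_eq[OF j1 b])
    then show ?thesis
      using c_Suc[OF r[of j]] b m by (simp add: k_def w_def nat_add_distrib)
  qed
  have "map x [k j..k (j + 1) - 1] = w j" for j
  proof -
    define s where "s = nat (j mod m)"
    have s: "s < length ws" "w j = ws ! s" using r by (simp_all add: s_def w_def)
    have u: "u = concat (take s ws) @ w j @ concat (drop (Suc s) ws)"
      unfolding u_def s(2) using s(1)
      by (metis concat.simps(2) concat_append id_take_nth_drop)
    have "x (k j + int t) = w j ! t" if t: "t < length (w j)" for t
    proof -
      have lt: "c s + int t < L" unfolding L_def using t by (subst u) (simp add: c_def)
      have "(k j + int t) mod L = (c s + int t) mod L"
        by (simp add: k_def s_def add.assoc)
      also have "\<dots> = c s + int t" using lt by (simp add: c_def)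
      finally have "x (k j + int t) = u ! (length (concat (take s ws)) + t)"
        by (simp add: x_def c_def nat_add_distrib)
      then show ?thesis using t by (subst (asm) u) (simp add: nth_append)
    qed
    then show ?thesis unfolding step map_upto_eq_iff by blast
  qed
  moreover have "strict_mono k"
    by (rule strict_mono_int_stepI) (simp add: step w_ne)
  ultimately have "cutting W x k" using w by (simp add: cutting_def)
  from cutting_shift_by[OF this, of "- a"]
  have "shift_by (- a) x \<in> bi_concatenations W" by (auto simp: bi_concatenations_eq)
  moreover have "shift_by (- a) x (a + int t) = concat ws ! t" if "t < length (concat ws)" for t
    using that by (simp add: shift_by_def x_def L_def u_def)
  ultimately show ?thesis by (rule that)
qed

section \<open>Subshifts with a fixed generator\<close>

locale coded =
  fixes A :: "'a set" and X :: "(int \<Rightarrow> 'a) set" and W :: "'a list set"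
  assumes sub: "subshift A X" and gen: "generator A X W"
begin

abbreviation (input) "S \<equiv> subtopology (full_shift A) X"

lemma X_sub: "X \<subseteq> topspace (full_shift A)" and X_ne: "X \<noteq> {}" and shift_X: "shift_map ` X = X"
  using sub closedin_subset by (auto simp: subshift_def)

lemma topspace_S: "topspace S = X"
  using X_sub by (simp add: Int_absorb1)

lemma shift_by_X: "x \<in> X \<Longrightarrow> shift_by n x \<in> X"
  using shift_by_in[OF shift_X] .

lemma W_ne: "[] \<notin> W" and X_closure: "X = full_shift A closure_of bi_concatenations W"
  using gen by (auto simp: generator_def)

text \<open>A set is contained in its \<open>closure_of\<close> once it lies in the topological
  space, so the letters must be shown to belong to \<open>A\<close>: each coordinate is covered by a
  finite concatenation.\<close>

lemma bi_concatenations_sub: "bi_concatenations W \<subseteq> X"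
proof -
  have "x i \<in> A" if x: "x \<in> bi_concatenations W" for x i
  proof -
    obtain k where k: "cutting W x k" using x by (auto simp: bi_concatenations_eq)
    \<comment> \<open>Modulus 1 makes the alignment condition vacuous.\<close>
    then have "x \<in> aligned W 1 0" by (auto simp: aligned_def)
    then obtain a ws where a: "ws \<in> lists W" "a \<le> - \<bar>i\<bar>" "\<bar>i\<bar> < a + int (length (concat ws))"
      "\<And>t. t < length (concat ws) \<Longrightarrow> x (a + int t) = concat ws ! t"
      by (rule aligned_window[where r = "\<bar>i\<bar>"]) auto
    have lt: "nat (i - a) < length (concat ws)" using a(2,3) by linarith
    have "x i = concat ws ! nat (i - a)" using a(4)[OF lt] a(2) by (simp split: if_splits)
    then have "x i \<in> set (concat ws)" using nth_mem[OF lt] by simp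
    then show ?thesis using a(1) gen by (auto simp: generator_def)
  qed
  then have "bi_concatenations W \<subseteq> topspace (full_shift A)" by (auto simp: topspace_full_shift)
  then show ?thesis unfolding X_closure by (rule closure_of_subset)
qed

lemma open_meets_bi_concatenations:
  assumes "openin S U" "U \<noteq> {}"
  shows "U \<inter> bi_concatenations W \<noteq> {}"
proof -
  obtain V where V: "openin (full_shift A) V" "U = V \<inter> X"
    using assms(1) by (auto simp: openin_subtopology)
  obtain x where "x \<in> V" "x \<in> X" using V assms(2) by auto
  then obtain y where "y \<in> bi_concatenations W" "y \<in> V"
    using V(1) unfolding X_closure in_closure_of by blast
  then show ?thesis using V(2) bi_concatenations_sub by auto
qed

lemma int_power_eq: "x \<in> X \<Longrightarrow> int_power S shift_map n x = shift_by n x"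
  by (rule int_power_shift_by[OF topspace_S shift_by_X, where c = 1, simplified])
     (simp_all add: shift_map_eq)

lemma int_power_int_power_eq:
  "x \<in> X \<Longrightarrow> int_power S (int_power S shift_map c) n x = shift_by (c * n) x"
  by (rule int_power_shift_by[OF topspace_S shift_by_X int_power_eq])

lemma openin_shift_preimage:
  assumes "openin S V"
  shows "openin S {x \<in> X. shift_by n x \<in> V}"
proof -
  have "continuous_map S S (shift_by n)"
    using continuous_map_shift_by[of A n] shift_by_X
    by (auto simp: continuous_map_in_subtopology continuous_map_from_subtopology)
  from openin_continuous_map_preimage[OF this assms] show ?thesis by (simp only: topspace_S)
qed

section \<open>Mixing implies total transitivity\<close>

text \<open>A cofinite set of return times must contain one of the infinitely many multiples of
  \<open>c\<close>.\<close>

lemma mixing_imp_totally_transitive: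
  assumes "mixing S shift_map"
  shows "totally_transitive S shift_map"
  unfolding totally_transitive_def transitive_def
proof (intro allI impI)
  fix c :: int and U V
  assume c: "c \<noteq> 0" and UV: "openin S U \<and> openin S V \<and> U \<noteq> {} \<and> V \<noteq> {}"
  have "finite (- return_times S shift_map U V)" using assms UV by (auto simp: mixing_def)
  moreover have "infinite (range (\<lambda>n. c * int n))"
    by (rule range_inj_infinite) (simp add: inj_def c)
  ultimately have "\<not> range (\<lambda>n. c * int n) \<subseteq> - return_times S shift_map U V"
    using finite_subset by blast
  then obtain n where "c * int n \<in> return_times S shift_map U V" by blast
  then obtain x where x: "x \<in> U" "int_power S shift_map (c * int n) x \<in> V"
    by (auto simp: return_times_def)
  moreover have "x \<in> X" using x UV openin_subset topspace_S by blast
  ultimately show "return_times S (int_power S shift_map c) U V \<noteq> {}"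
    using int_power_eq int_power_int_power_eq by (force simp: return_times_def)
qed

section \<open>Total transitivity implies mixing\<close>

text \<open>The classes with residues \<open>0\<close> to \<open>d - 1\<close> cover all
  concatenations and are invariant under the \<open>d\<close>-th power of the shift, so one of them
  is dense; a shift carries it to the class of \<open>c\<close>.\<close>

lemma aligned_dense:
  assumes tt: "totally_transitive S shift_map" and d: "0 < d"
    and U: "openin S U" "U \<noteq> {}"
  shows "U \<inter> aligned W d c \<noteq> {}"
proof -
  let ?T = "int_power S shift_map (int d)"
  have cov: "\<exists>i\<in>{0..<int d}. U \<inter> aligned W d i \<noteq> {}" if U: "openin S U" "U \<noteq> {}" for U
  proof -
    obtain x k where x: "x \<in> U" "cutting W x k"
      using open_meets_bi_concatenations[OF U] by (auto simp: bi_concatenations_eq)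
    have "int d dvd k 0 - k 0 mod int d" by (simp add: dvd_minus_mod)
    then have "x \<in> aligned W d (k 0 mod int d)" using x by (auto simp: aligned_def)
    then show ?thesis using x d by (intro bexI[of _ "k 0 mod int d"]) auto
  qed
  have inv: "int_power S ?T n x \<in> aligned W d i" if "x \<in> aligned W d i" "x \<in> topspace S" for n i x
  proof -
    have "int_power S ?T n x = shift_by (int d * n) x"
      using that int_power_int_power_eq unfolding topspace_S by blast
    then show ?thesis
      using aligned_shift_by[OF that(1), of "int d * n"]
        aligned_cong[of d "i - int d * n" i W] by auto
  qed
  have cont: "openin S {x \<in> topspace S. int_power S ?T n x \<in> V}" if "openin S V" for n V
  proof -
    have "{x \<in> topspace S. int_power S ?T n x \<in> V} = {x \<in> X. shift_by (int d * n) x \<in> V}"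
      using int_power_int_power_eq unfolding topspace_S by auto
    then show ?thesis using openin_shift_preimage[OF that] by simp
  qed
  have "transitive S ?T" using tt d by (auto simp: totally_transitive_def)
  then have "\<exists>i\<in>{0..<int d}. \<forall>U. openin S U \<longrightarrow> U \<noteq> {} \<longrightarrow> U \<inter> aligned W d i \<noteq> {}"
    by (rule transitive_finite_cover_dense[OF _ _ cov cont inv]) (use X_ne topspace_S in auto)
  then obtain i where i: "\<And>U. openin S U \<Longrightarrow> U \<noteq> {} \<Longrightarrow> U \<inter> aligned W d i \<noteq> {}"
    by blast
  \<comment> \<open>Shifting by \<open>i - c\<close> turns class \<open>i\<close> into class
    \<open>c\<close>, so a point of class \<open>i\<close> is sought in the preimage of
    \<open>U\<close>.\<close>
  let ?U = "{x \<in> X. shift_by (i - c) x \<in> U}"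
  obtain y where y: "y \<in> U" using U by blast
  then have "y \<in> X" using U openin_subset topspace_S by blast
  then have "shift_by (c - i) y \<in> ?U" using y shift_by_X by simp
  then obtain x where "x \<in> ?U" "x \<in> aligned W d i"
    using i[OF openin_shift_preimage[OF U(1)]] by blast
  then show ?thesis using aligned_shift_by[of x W d i "i - c"] by auto
qed

text \<open>A block \<open>ps\<close> forcing membership in \<open>U\<close> and a block
  \<open>qs\<close> forcing the shifted point into \<open>V\<close> are joined by a filler
  \<open>fs\<close>. The distance \<open>n\<close> dictates the length of \<open>fs\<close>, which
  must be a large multiple of \<open>d\<close>.\<close>

lemma eventually_joined:
  assumes tt: "totally_transitive S shift_map"
    and U: "openin S U" "U \<noteq> {}" and V: "openin S V" "V \<noteq> {}"
  shows "\<exists>M. \<forall>n\<ge>M. \<exists>z\<in>U. shift_by n z \<in> V"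
proof -
  define L where "L = (\<lambda>ws. length (concat ws)) ` lists W"
  obtain x k where "cutting W x k"
    using open_meets_bi_concatenations[OF U] by (auto simp: bi_concatenations_eq)
  then obtain w where w: "w \<in> W" by (auto simp: cutting_def)
  have "0 \<in> L" unfolding L_def by (rule image_eqI[of _ _ "[]"]) auto
  moreover have "a + b \<in> L" if ab: "a \<in> L" "b \<in> L" for a b
  proof -
    obtain us vs where "us \<in> lists W" "vs \<in> lists W"
      "a = length (concat us)" "b = length (concat vs)" using ab by (auto simp: L_def)
    then show ?thesis unfolding L_def by (intro image_eqI[of _ _ "us @ vs"]) auto
  qed
  moreover have "length w \<in> L" unfolding L_def using w by (intro image_eqI[of _ _ "[w]"]) auto
  moreover have "0 < length w" using w W_ne by auto
  ultimately obtain d N where d: "0 < d" and dvd: "\<And>a. a \<in> L \<Longrightarrow> d dvd a"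
    and N: "\<And>n. N \<le> n \<Longrightarrow> d dvd n \<Longrightarrow> n \<in> L"
    by (rule additive_set_eventually_multiples) blast+
  have dvd': "d dvd length (concat ws)" if "ws \<in> lists W" for ws
    using dvd that by (auto simp: L_def)
  obtain x where x: "x \<in> U" "x \<in> aligned W d 0" using aligned_dense[OF tt d U] by blast
  obtain r where "0 \<le> r" and r: "\<And>z. z \<in> X \<Longrightarrow> (\<And>i. - r \<le> i \<Longrightarrow> i \<le> r \<Longrightarrow> z i = x i) \<Longrightarrow> z \<in> U"
    using openin_full_shift_window[OF U(1) x(1) X_sub] by metis
  obtain a ps where p: "ps \<in> lists W" "a \<le> - r" "r < a + int (length (concat ps))"
    "int d dvd a" "\<And>t. t < length (concat ps) \<Longrightarrow> x (a + int t) = concat ps ! t"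
    using aligned_window[OF x(2) dvd', of r] by (metis diff_zero)
  define b where "b = a + int (length (concat ps))"
  have b: "int d dvd b" using p dvd'[OF p(1)] by (simp add: b_def)
  \<comment> \<open>The residue of \<open>n\<close> is fixed first, because the block for
    \<open>V\<close> is chosen according to it.\<close>
  have "\<exists>M. \<forall>n\<ge>M. n mod int d = e \<longrightarrow> (\<exists>z\<in>U. shift_by n z \<in> V)" for e
  proof -
    \<comment> \<open>With class \<open>- e\<close>, the start \<open>a'\<close> of the block
      satisfies \<open>a' + n\<close> congruent to 0, like the end \<open>b\<close> of the first
      block.\<close>
    obtain y where y: "y \<in> V" "y \<in> aligned W d (- e)" using aligned_dense[OF tt d V] by blast
    obtain s where s: "\<And>z. z \<in> X \<Longrightarrow> (\<And>i. - s \<le> i \<Longrightarrow> i \<le> s \<Longrightarrow> z i = y i) \<Longrightarrow> z \<in> V"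
      using openin_full_shift_window[OF V(1) y(1) X_sub] by metis
    obtain a' qs where q: "qs \<in> lists W" "a' \<le> - s" "s < a' + int (length (concat qs))"
      "int d dvd a' + e" "\<And>t. t < length (concat qs) \<Longrightarrow> y (a' + int t) = concat qs ! t"
      using aligned_window[OF y(2) dvd', of s] by (metis diff_minus_eq_add)
    have "\<exists>z\<in>U. shift_by n z \<in> V" if n: "int N + b - a' \<le> n" "n mod int d = e" for n
    proof -
      have "int d dvd n - e" using n(2) by (metis dvd_minus_mod)
      from dvd_diff[OF dvd_add[OF this q(4)] b]
      have D: "int d dvd a' + n - b" by (simp add: algebra_simps)
      \<comment> \<open>The gap between the end \<open>b\<close> of \<open>ps\<close> and the start
        \<open>a' + n\<close> of the displaced \<open>qs\<close>; the lower bound on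
        \<open>n\<close> makes it at least \<open>N\<close>.\<close>
      define l where "l = nat (a' + n - b)"
      have l: "int l = a' + n - b" using n(1) by (simp add: l_def)
      have "int N \<le> int l" "int d dvd int l" using n(1) D unfolding l by simp_all
      then have "l \<in> L" using N by simp
      then obtain fs where f: "fs \<in> lists W" "length (concat fs) = l" by (auto simp: L_def)
      define ws where "ws = ps @ fs @ qs"
      \<comment> \<open>\<open>ps\<close> covers the nonempty window from \<open>- r\<close> to
        \<open>r\<close>, so it is not empty.\<close>
      have "ws \<noteq> []"
        using p(2,3) \<open>0 \<le> r\<close> by (auto simp: ws_def)
      moreover have "ws \<in> lists W" using p f q by (auto simp: ws_def)
      ultimately obtain z where z: "z \<in> bi_concatenations W"
        "\<And>t. t < length (concat ws) \<Longrightarrow> z (a + int t) = concat ws ! t"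
        using periodic_concatenation[of ws W a] W_ne by blast
      have zX: "z \<in> X" using z bi_concatenations_sub by blast
      have "z i = x i" if i: "- r \<le> i" "i \<le> r" for i
      proof -
        define t where "t = nat (i - a)"
        have t: "i = a + int t" "t < length (concat ps)" using i p(2,3) by (auto simp: t_def)
        then show ?thesis using z(2)[of t] p(5)[of t] by (simp add: ws_def nth_append)
      qed
      then have "z \<in> U" using r zX by blast
      moreover have "shift_by n z i = y i" if i: "- s \<le> i" "i \<le> s" for i
      proof -
        define t where "t = nat (i - a')"
        have t: "i = a' + int t" "t < length (concat qs)" using i q(2,3) by (auto simp: t_def)
        have i': "i + n = a + int (length (concat ps) + l + t)" using t l by (simp add: b_def)
        have "z (i + n) = concat ws ! (length (concat ps) + l + t)"
          unfolding i' by (rule z(2)) (use t f in \<open>simp add: ws_def\<close>)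
        also have "\<dots> = concat qs ! t" using f by (simp add: ws_def nth_append)
        finally show ?thesis using q(5) t by (simp add: shift_by_def)
      qed
      then have "shift_by n z \<in> V" using s shift_by_X zX by blast
      ultimately show ?thesis by blast
    qed
    then show ?thesis by blast
  qed
  then obtain M where M: "\<And>e n. M e \<le> n \<Longrightarrow> n mod int d = e \<Longrightarrow> \<exists>z\<in>U. shift_by n z \<in> V"
    by metis
  \<comment> \<open>There are finitely many residues, so the largest of their thresholds works for
    all \<open>n\<close>.\<close>
  have "\<exists>z\<in>U. shift_by n z \<in> V" if "Max (M ` {0..<int d}) \<le> n" for n
  proof (rule M)
    have "n mod int d \<in> {0..<int d}" using d by simp
    then have "M (n mod int d) \<le> Max (M ` {0..<int d})" by (intro Max_ge) auto
    then show "M (n mod int d) \<le> n" using that by linarith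
  qed simp
  then show ?thesis by blast
qed

text \<open>Joining \<open>U\<close> to \<open>V\<close> handles large positive times. Joining
  \<open>V\<close> to \<open>U\<close> and reversing the shift handles large negative ones, leaving
  a bounded set of exceptions.\<close>

lemma totally_transitive_imp_mixing:
  assumes tt: "totally_transitive S shift_map"
  shows "mixing S shift_map"
  unfolding mixing_def
proof (intro allI impI)
  fix U V assume UV: "openin S U \<and> openin S V \<and> U \<noteq> {} \<and> V \<noteq> {}"
  then have UX: "U \<subseteq> X" "V \<subseteq> X" using openin_subset topspace_S by blast+
  obtain M where M: "\<And>n. M \<le> n \<Longrightarrow> \<exists>z\<in>U. shift_by n z \<in> V"
    using eventually_joined[OF tt, of U V] UV by blast
  obtain M' where M': "\<And>n. M' \<le> n \<Longrightarrow> \<exists>z\<in>V. shift_by n z \<in> U"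
    using eventually_joined[OF tt, of V U] UV by blast
  have "n \<in> return_times S shift_map U V" if "M \<le> n \<or> M' \<le> - n" for n
  proof -
    have "\<exists>z\<in>U. shift_by n z \<in> V"
    proof (cases "M \<le> n")
      case False
      then obtain z where z: "z \<in> V" "shift_by (- n) z \<in> U" using \<open>M \<le> n \<or> M' \<le> - n\<close> M' by blast
      then show ?thesis by (intro bexI[of _ "shift_by (- n) z"]) auto
    qed (rule M)
    then show ?thesis using int_power_eq UX by (fastforce simp: return_times_def)
  qed
  then have "- return_times S shift_map U V \<subseteq> {- M'..M}"
    by (metis ComplD atLeastAtMost_iff linear neg_le_iff_le minus_minus subsetI)
  then show "finite (- return_times S shift_map U V)" by (rule finite_subset) simp
qed

end

theorem theorem2p2:
  fixes A :: "'a set" and X :: "(int \<Rightarrow> 'a) set"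
  assumes "finite A" and "coded_system A X"
  shows "mixing (subtopology (full_shift A) X) shift_map \<longleftrightarrow>
         totally_transitive (subtopology (full_shift A) X) shift_map"
proof -
  obtain W where "coded A X W"
    using assms(2) by (auto simp: coded_system_def coded_def)
  then show ?thesis
    using coded.mixing_imp_totally_transitive coded.totally_transitive_imp_mixing by blast
qed

end
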